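(* For every integer $n\ge1$, the bivariate Laurent polynomial $$\hat a_n(z_1,z_2)=\sum_{i=0}^{n-1}u_{n-i}^{n-i-1}(z_1)\,u_{i+1}^{i}(z_2)-\sum_{i=0}^{n-2}u_{n-i-1}^{n-i-2}(z_1)\,u_{i+1}^{i}(z_2)$$ (the second sum being empty for $n=1$) is interpolatory, generates polynomials up to degree $2n-1$, reproduces polynomials up to degree $2n-1$, and is minimally supported, i.e. the size of its support is minimal among the supports of all symmetric interpolatory symbols that generate polynomials up to degree $2n-1$.
   Context: A symbol is a bivariate Laurent polynomial $a(z_1,z_2)=\sum_{\alpha\in\mathbb Z^2}a_\alpha z_1^{\alpha_1}z_2^{\alpha_2}$ with finitely many nonzero real coefficients $a_\alpha$, regarded as a function of $(z_1,z_2)\in(\mathbb C\setminus\{0\})^2$. For $k=(k_1,k_2)\in\mathbb N_0^2$, $D^k=\partial_{z_1}^{k_1}\partial_{z_2}^{k_2}$ and $|k|=k_1+k_2$. Let $E'=\{(-1,1),(1,-1),(-1,-1)\}$. Symmetric: $a(z_1,z_2)=a(1/z_1,z_2)=a(z_1,1/z_2)=a(z_2,z_1)$. Generates polynomials up to degree $m$: $(D^k a)(z)=0$ for all $z\in E'$ and all $k\in\mathbb N_0^2$ with $0\le|k|\le m$. Reproduces polynomials up to degree $m'$ (for a symbol that generates polynomials up to some degree $m\ge m'$): $a(1,1)=4$ and $(D^k a)(1,1)=0$ for all $k\in\mathbb N_0^2$ with $0<|k|\le m'$. Interpolatory: $a(z_1,z_2)+a(z_1,-z_2)+a(-z_1,z_2)+a(-z_1,-z_2)=4$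 (equivalently $a_{(0,0)}=1$ and $a_{2\alpha}=0$ for $\alpha\in\mathbb Z^2\setminus\{(0,0)\}$). Support: the support of a symbol is the convex hull in $\mathbb R^2$ of $\{\alpha\in\mathbb Z^2: a_\alpha\ne0\}$, and the size of the support is the area of this convex hull. Univariate pseudo-splines: with $\sigma(z)=\frac{(1+z)^2}{4z}$ and $\delta(z)=-\frac{(1-z)^2}{4z}$, $$u_n^l(z)=2\,\sigma(z)^n\sum_{i=0}^{l}\binom{n+i-1}{i}\delta(z)^i,\qquad 0\le l<n.$$ *)

theory Defs
  imports "HOL-Analysis.Analysis" "HOL-Library.Poly_Mapping"
begin

text \<open>
  Real Laurent polynomials in one and two variables are finitely supported coefficient families,
  indexed by the (possibly negative) exponents.
\<close>

type_synonym laurent = "int \<Rightarrow>\<^sub>0 real"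
type_synonym symbol = "(int \<times> int) \<Rightarrow>\<^sub>0 real"

abbreviation coef :: "('i \<Rightarrow>\<^sub>0 real) \<Rightarrow> 'i \<Rightarrow> real"
  where "coef \<equiv> Poly_Mapping.lookup"

definition leval :: "laurent \<Rightarrow> complex \<Rightarrow> complex"
  where "leval p z = (\<Sum>i\<in>Poly_Mapping.keys p. of_real (coef p i) * z powi i)"

text \<open>
  As \<^term>\<open>0 powi i\<close> is a junk value for negative \<open>i\<close>, values of these evaluation
  functions are only meaningful at non-zero arguments.
\<close>

definition seval :: "symbol \<Rightarrow> complex \<Rightarrow> complex \<Rightarrow> complex"
  where "seval a z1 z2 =
    (\<Sum>\<alpha>\<in>Poly_Mapping.keys a. of_real (coef a \<alpha>) * z1 powi fst \<alpha> * z2 powi snd \<alpha>)"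

definition Dk :: "nat \<times> nat \<Rightarrow> (complex \<Rightarrow> complex \<Rightarrow> complex) \<Rightarrow> complex \<Rightarrow> complex \<Rightarrow> complex"
  where "Dk k f z1 z2 =
    (deriv ^^ fst k) (\<lambda>w1. (deriv ^^ snd k) (\<lambda>w2. f w1 w2) z2) z1"

definition E' :: "(complex \<times> complex) set"
  where "E' = {(-1, 1), (1, -1), (-1, -1)}"

definition symmetric_symbol :: "symbol \<Rightarrow> bool"
  where "symmetric_symbol a \<longleftrightarrow> (\<forall>z1 z2. z1 \<noteq> 0 \<longrightarrow> z2 \<noteq> 0 \<longrightarrow>
    seval a z1 z2 = seval a (1 / z1) z2 \<and>
    seval a z1 z2 = seval a z1 (1 / z2) \<and>
    seval a z1 z2 = seval a z2 z1)"

definition generates_polynomials :: "symbol \<Rightarrow> nat \<Rightarrow> bool"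
  where "generates_polynomials a m \<longleftrightarrow>
    (\<forall>(z1, z2)\<in>E'. \<forall>k. fst k + snd k \<le> m \<longrightarrow> Dk k (seval a) z1 z2 = 0)"

definition reproduces_polynomials :: "symbol \<Rightarrow> nat \<Rightarrow> bool"
  where "reproduces_polynomials a m' \<longleftrightarrow>
    (\<exists>m\<ge>m'. generates_polynomials a m) \<and>
    seval a 1 1 = 4 \<and>
    (\<forall>k. 0 < fst k + snd k \<and> fst k + snd k \<le> m' \<longrightarrow> Dk k (seval a) 1 1 = 0)"

definition interpolatory :: "symbol \<Rightarrow> bool"
  where "interpolatory a \<longleftrightarrow> (\<forall>z1 z2. z1 \<noteq> 0 \<longrightarrow> z2 \<noteq> 0 \<longrightarrow>
    seval a z1 z2 + seval a z1 (- z2) + seval a (- z1) z2 + seval a (- z1) (- z2) = 4)"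

definition symbol_support :: "symbol \<Rightarrow> (real \<times> real) set"
  where "symbol_support a =
    convex hull {(real_of_int \<alpha>1, real_of_int \<alpha>2) | \<alpha>1 \<alpha>2. coef a (\<alpha>1, \<alpha>2) \<noteq> 0}"

definition support_size :: "symbol \<Rightarrow> real"
  where "support_size a = measure lborel (symbol_support a)"

definition Z :: laurent
  where "Z = Poly_Mapping.single 1 1"

text \<open>\<open>(1 + z)\<^sup>2 / (4 z)\<close> and \<open>- (1 - z)\<^sup>2 / (4 z)\<close>; the factor \<open>1 / (4 z)\<close> is the monomial
  with exponent \<open>- 1\<close> and coefficient \<open>1 / 4\<close>.\<close>

definition sigma :: laurent
  where "sigma = (1 + Z)\<^sup>2 * Poly_Mapping.single (- 1) (1 / 4)"

definition delta :: laurent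
  where "delta = - ((1 - Z)\<^sup>2 * Poly_Mapping.single (- 1) (1 / 4))"

definition pseudo_spline :: "nat \<Rightarrow> nat \<Rightarrow> laurent"
  where "pseudo_spline n l =
    2 * sigma ^ n * (\<Sum>i=0..l. of_nat ((n + i - 1) choose i) * delta ^ i)"

text \<open>The bivariate Laurent polynomial \<open>p(z\<^sub>1) q(z\<^sub>2)\<close>.\<close>

definition tensor :: "laurent \<Rightarrow> laurent \<Rightarrow> symbol"
  where "tensor p q =
    (\<Sum>i\<in>Poly_Mapping.keys p. \<Sum>j\<in>Poly_Mapping.keys q.
      Poly_Mapping.single (i, j) (coef p i * coef q j))"

definition a_hat :: "nat \<Rightarrow> symbol"
  where "a_hat n =
    (\<Sum>i<n. tensor (pseudo_spline (n - i) (n - i - 1)) (pseudo_spline (i + 1) i)) -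
    (\<Sum>i<n - 1. tensor (pseudo_spline (n - i - 1) (n - i - 2)) (pseudo_spline (i + 1) i))"


lemma leval_superset:
  assumes "finite S" "Poly_Mapping.keys p \<subseteq> S"
  shows "leval p z = (\<Sum>i\<in>S. of_real (coef p i) * z powi i)"
  unfolding leval_def using assms
  by (intro sum.mono_neutral_left) (auto simp: in_keys_iff)

lemma seval_superset:
  assumes "finite S" "Poly_Mapping.keys a \<subseteq> S"
  shows "seval a z1 z2 = (\<Sum>\<alpha>\<in>S. of_real (coef a \<alpha>) * z1 powi fst \<alpha> * z2 powi snd \<alpha>)"
  unfolding seval_def using assms
  by (intro sum.mono_neutral_left) (auto simp: in_keys_iff)

lemma leval_0 [simp]: "leval 0 z = 0"
  by (simp add: leval_def)

lemma seval_0 [simp]: "seval 0 z1 z2 = 0"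
  by (simp add: seval_def)

lemma leval_single [simp]: "leval (Poly_Mapping.single i c) z = of_real c * z powi i"
  by (simp add: leval_def)

lemma seval_single [simp]:
  "seval (Poly_Mapping.single \<alpha> c) z1 z2 = of_real c * z1 powi fst \<alpha> * z2 powi snd \<alpha>"
  by (simp add: seval_def)

lemma leval_1 [simp]: "leval 1 z = 1"
  by (simp add: leval_def)

lemma leval_add [simp]: "leval (p + q) z = leval p z + leval q z"
proof -
  let ?S = "Poly_Mapping.keys p \<union> Poly_Mapping.keys q"
  have "Poly_Mapping.keys (p + q) \<subseteq> ?S" by (rule keys_add)
  then show ?thesis
    by (simp add: leval_superset[of ?S] lookup_add algebra_simps sum.distrib)
qed

lemma seval_add [simp]: "seval (a + b) z1 z2 = seval a z1 z2 + seval b z1 z2"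
proof -
  let ?S = "Poly_Mapping.keys a \<union> Poly_Mapping.keys b"
  have "Poly_Mapping.keys (a + b) \<subseteq> ?S" by (rule keys_add)
  then show ?thesis
    by (simp add: seval_superset[of ?S] lookup_add algebra_simps sum.distrib)
qed

lemma leval_diff [simp]: "leval (p - q) z = leval p z - leval q z"
  using leval_add[of "p - q" q z] by simp

lemma leval_uminus [simp]: "leval (- p) z = - leval p z"
  using leval_diff[of 0 p z] by simp

lemma seval_diff [simp]: "seval (a - b) z1 z2 = seval a z1 z2 - seval b z1 z2"
  using seval_add[of "a - b" b z1 z2] by simp

lemma leval_sum [simp]: "leval (sum f A) z = (\<Sum>x\<in>A. leval (f x) z)"
  by (induction A rule: infinite_finite_induct) auto

lemma seval_sum [simp]: "seval (sum f A) z1 z2 = (\<Sum>x\<in>A. seval (f x) z1 z2)"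
  by (induction A rule: infinite_finite_induct) auto

lemma laurent_expand:
  fixes p :: laurent
  shows "p = (\<Sum>i\<in>Poly_Mapping.keys p. Poly_Mapping.single i (coef p i))"
  by (rule poly_mapping_eqI) (auto simp: lookup_sum lookup_single when_def in_keys_iff)

lemma leval_mult [simp]:
  assumes "z \<noteq> 0"
  shows "leval (p * q) z = leval p z * leval q z"
proof -
  have "p * q = (\<Sum>i\<in>Poly_Mapping.keys p. \<Sum>j\<in>Poly_Mapping.keys q.
      Poly_Mapping.single (i + j) (coef p i * coef q j))"
    by (subst laurent_expand[of p], subst laurent_expand[of q])
       (simp add: sum_product mult_single)
  then have "leval (p * q) z = (\<Sum>i\<in>Poly_Mapping.keys p. \<Sum>j\<in>Poly_Mapping.keys q.
      of_real (coef p i * coef q j) * z powi (i + j))"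
    by simp
  also have "\<dots> = leval p z * leval q z"
    using assms unfolding leval_def sum_product
    by (intro sum.cong refl) (simp add: power_int_add)
  finally show ?thesis .
qed

lemma leval_power [simp]: "z \<noteq> 0 \<Longrightarrow> leval (p ^ n) z = leval p z ^ n"
  by (induction n) auto

lemma leval_of_nat [simp]: "leval (of_nat n) z = of_nat n"
  by (induction n) auto

lemma leval_numeral [simp]: "leval (numeral n) z = numeral n"
  using leval_of_nat[of "numeral n" z] by simp

lemma leval_sigma: "z \<noteq> 0 \<Longrightarrow> leval sigma z = (1 + z)\<^sup>2 / (4 * z)"
  by (simp add: sigma_def Z_def power_int_minus field_simps)

lemma leval_delta: "z \<noteq> 0 \<Longrightarrow> leval delta z = - ((1 - z)\<^sup>2 / (4 * z))"
  by (simp add: delta_def Z_def power_int_minus field_simps)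

lemma leval_pseudo_spline:
  assumes "z \<noteq> 0"
  shows "leval (pseudo_spline n l) z =
    2 * ((1 + z)\<^sup>2 / (4 * z)) ^ n *
      (\<Sum>i=0..l. of_nat ((n + i - 1) choose i) * (- ((1 - z)\<^sup>2 / (4 * z))) ^ i)"
  using assms by (simp add: pseudo_spline_def leval_sigma leval_delta)

lemma seval_tensor: "seval (tensor p q) z1 z2 = leval p z1 * leval q z2"
  unfolding tensor_def leval_def sum_product by (simp add: mult_ac)

lemma seval_a_hat:
  "seval (a_hat n) z1 z2 =
    (\<Sum>i<n. leval (pseudo_spline (n - i) (n - i - 1)) z1 * leval (pseudo_spline (i + 1) i) z2) -
    (\<Sum>i<n - 1. leval (pseudo_spline (n - i - 1) (n - i - 2)) z1 *
      leval (pseudo_spline (i + 1) i) z2)"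
  by (simp add: a_hat_def seval_tensor)

end

theory Submission
  imports Defs
begin

text \<open>
  Write \<open>U r\<close> for the pseudo-spline \<open>u_{r+1}^r\<close>. With \<open>c = binom(2 r + 1, r + 1)\<close> one has
  \<open>U (r + 1) - U r = 2 c (\<sigma> \<delta>)^(r+1) (\<sigma> - \<delta>)\<close>, which is antisymmetric in \<open>\<sigma>\<close> and \<open>\<delta>\<close>. Hence each
  \<open>U r\<close> is interpolatory; moreover \<open>U r\<close> vanishes to order \<open>2 r + 2\<close> at \<open>-1\<close>, and
  \<open>U (r + 1) - U r\<close> does so at both \<open>1\<close> and \<open>-1\<close>. Grouping the two sums as
  \<open>a_hat (m + 1) = U m \<otimes> U 0 + (\<Sum>i < m. U (m - 1 - i) \<otimes> (U (i + 1) - U i))\<close>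
  shows that the symbol vanishes to order \<open>2 m + 2\<close> on \<open>E'\<close>; for interpolatory symbols this
  implies reproduction, because the values at the four sign points add up to \<open>4\<close>.

  For minimality even inclusion of supports holds. The support of \<open>a_hat (m + 1)\<close> lies in the
  octagon spanned by \<open>(\<plusminus>(2 m + 1), \<plusminus>1)\<close> and \<open>(\<plusminus>1, \<plusminus>(2 m + 1))\<close>, while every competitor has
  a nonzero coefficient at some \<open>(i, j)\<close> with \<open>\<bar>i\<bar> \<ge> 2 m + 1\<close> and \<open>j\<close> odd, so by symmetry and
  convexity its support contains this octagon. To find that coefficient, note that the odd-odd part
  of the coefficients integrates polynomials of degree at most \<open>2 m\<close> in \<open>i\<close> to their value at \<open>0\<close>,
  and that \<open>\<Prod>k<m. i^2 - (2 k + 1)^2\<close> vanishes at the odd integers of modulus below \<open>2 m + 1\<close>, but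
  not at \<open>0\<close>.
\<close>

section \<open>Weighted coefficients and Hasse derivatives\<close>

definition weighted :: "('i \<Rightarrow> real) \<Rightarrow> ('i \<Rightarrow>\<^sub>0 real) \<Rightarrow> 'i \<Rightarrow>\<^sub>0 real"
  where "weighted g p = Poly_Mapping.mapp (\<lambda>i. (*) (g i)) p"

lemma coef_weighted [simp]: "coef (weighted g p) i = g i * coef p i"
  by (simp add: weighted_def lookup_mapp when_def in_keys_iff)

lemma weighted_add: "weighted g (p + q) = weighted g p + weighted g q"
  by (rule poly_mapping_eqI) (simp add: lookup_add algebra_simps)

lemma weighted_diff: "weighted g (p - q) = weighted g p - weighted g q"
  by (rule poly_mapping_eqI) (simp add: lookup_minus algebra_simps)

lemma weighted_sum: "weighted g (sum f A) = (\<Sum>x\<in>A. weighted g (f x))"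
  by (rule poly_mapping_eqI) (simp add: lookup_sum sum_distrib_left)

lemma weighted_single: "weighted g (Poly_Mapping.single i c) = Poly_Mapping.single i (g i * c)"
  by (rule poly_mapping_eqI) (simp add: lookup_single when_def)

lemma weighted_weighted: "weighted g (weighted h p) = weighted (\<lambda>i. g i * h i) p"
  by (rule poly_mapping_eqI) (simp add: mult.assoc)

lemma leval_weighted:
  "leval (weighted g p) z = (\<Sum>i\<in>Poly_Mapping.keys p. of_real (g i * coef p i) * z powi i)"
  by (subst leval_superset[of "Poly_Mapping.keys p"]) (auto simp: in_keys_iff)

lemma seval_weighted:
  "seval (weighted g a) z1 z2 =
    (\<Sum>\<alpha>\<in>Poly_Mapping.keys a. of_real (g \<alpha> * coef a \<alpha>) * z1 powi fst \<alpha> * z2 powi snd \<alpha>)"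
  by (subst seval_superset[of "Poly_Mapping.keys a"]) (auto simp: in_keys_iff)

lemma coef_tensor [simp]: "coef (tensor p q) (i, j) = coef p i * coef q j"
proof -
  have "coef (tensor p q) (i, j) = (\<Sum>i'\<in>Poly_Mapping.keys p. \<Sum>j'\<in>Poly_Mapping.keys q.
      if j' = j then if i' = i then coef p i * coef q j else 0 else 0)"
    unfolding tensor_def lookup_sum by (intro sum.cong refl) (auto simp: lookup_single when_def)
  also have "\<dots> = coef p i * coef q j"
    by (cases "coef q j = 0") (auto simp: in_keys_iff)
  finally show ?thesis .
qed

lemma tensor_diff_right: "tensor p (q - r) = tensor p q - tensor p r"
  by (rule poly_mapping_eqI) (auto simp: lookup_minus algebra_simps)

lemma weighted_tensor:
  "weighted (\<lambda>\<alpha>. g (fst \<alpha>) * h (snd \<alpha>)) (tensor p q) = tensor (weighted g p) (weighted h q)"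
  by (rule poly_mapping_eqI) (auto simp: mult_ac)

text \<open>
  Scaling the Hasse derivatives by powers of the variables keeps the exponents in place:
  \<open>hasse_deriv k p\<close> represents \<open>z^k p^(k)(z) / k!\<close>.
\<close>

definition hasse_deriv :: "nat \<Rightarrow> laurent \<Rightarrow> laurent"
  where "hasse_deriv k = weighted (\<lambda>i. of_int i gchoose k)"

definition hasse_deriv2 :: "nat \<times> nat \<Rightarrow> symbol \<Rightarrow> symbol"
  where "hasse_deriv2 k =
    weighted (\<lambda>\<alpha>. (of_int (fst \<alpha>) gchoose fst k) * (of_int (snd \<alpha>) gchoose snd k))"

lemma hasse_deriv2_0 [simp]: "hasse_deriv2 (0, 0) a = a"
  by (rule poly_mapping_eqI) (simp add: hasse_deriv2_def)

lemma hasse_deriv2_tensor: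
  "hasse_deriv2 k (tensor p q) = tensor (hasse_deriv (fst k) p) (hasse_deriv (snd k) q)"
  unfolding hasse_deriv2_def hasse_deriv_def by (rule weighted_tensor)

lemma of_real_gbinomial:
  "of_real (x gchoose k) = (of_real x gchoose k :: 'a :: {real_div_algebra, field_char_0})"
  by (simp add: gbinomial_prod_rev of_real_prod)

lemma higher_deriv_power_int_sum:
  fixes c :: "'i \<Rightarrow> complex" and e :: "'i \<Rightarrow> int"
  assumes "z \<noteq> 0"
  shows "(deriv ^^ k) (\<lambda>w. \<Sum>i\<in>S. c i * w powi e i) z =
    (\<Sum>i\<in>S. c i * (fact k * (of_int (e i) gchoose k)) * z powi (e i - int k))"
  using assms
proof (induction k arbitrary: z)
  case (Suc k)
  let ?b = "\<lambda>k i. fact k * (of_int (e i) gchoose k) :: complex"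
  let ?F = "\<lambda>w. \<Sum>i\<in>S. c i * ?b k i * w powi (e i - int k)"
  have absorb: "?b k i * of_int (e i - int k) = ?b (Suc k) i" for i
    using gbinomial_mult_1'[of "of_int (e i) :: complex" k] by (simp add: algebra_simps)
  have "\<forall>\<^sub>F w in nhds z. w \<in> - {0}"
    using Suc.prems by (intro eventually_nhds_in_open) auto
  then have "\<forall>\<^sub>F w in nhds z. (deriv ^^ k) (\<lambda>w. \<Sum>i\<in>S. c i * w powi e i) w = ?F w"
    by eventually_elim (use Suc.IH in auto)
  then have "(deriv ^^ Suc k) (\<lambda>w. \<Sum>i\<in>S. c i * w powi e i) z = deriv ?F z"
    by (simp add: deriv_cong_ev)
  also have "\<dots> = (\<Sum>i\<in>S. c i * ?b k i * (of_int (e i - int k) * z powi (e i - int k - 1) * 1))"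
    using Suc.prems
    by (intro DERIV_imp_deriv DERIV_cmult DERIV_sum DERIV_power_int DERIV_ident) auto
  also have "\<dots> = (\<Sum>i\<in>S. c i * ?b (Suc k) i * z powi (e i - int (Suc k)))"
    unfolding absorb[symmetric] by (intro sum.cong refl) (simp add: diff_diff_eq add.commute)
  finally show ?case .
qed simp

lemma Dk_seval:
  assumes "z1 \<noteq> 0" "z2 \<noteq> 0"
  shows "Dk k (seval a) z1 z2 =
    fact (fst k) * fact (snd k) * seval (hasse_deriv2 k a) z1 z2 / (z1 ^ fst k * z2 ^ snd k)"
proof -
  let ?K = "Poly_Mapping.keys a"
  let ?b = "\<lambda>\<alpha>. of_real (coef a \<alpha>) * (fact (snd k) * (of_int (snd \<alpha>) gchoose snd k)) *
    z2 powi (snd \<alpha> - int (snd k)) :: complex"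
  have inner: "(deriv ^^ snd k) (\<lambda>w2. seval a w1 w2) z2 = (\<Sum>\<alpha>\<in>?K. ?b \<alpha> * w1 powi fst \<alpha>)" for w1
    unfolding seval_def by (subst higher_deriv_power_int_sum[OF assms(2)]) (simp add: mult_ac)
  have "Dk k (seval a) z1 z2 =
      (\<Sum>\<alpha>\<in>?K. ?b \<alpha> * (fact (fst k) * (of_int (fst \<alpha>) gchoose fst k)) *
        z1 powi (fst \<alpha> - int (fst k)))"
    unfolding Dk_def inner by (rule higher_deriv_power_int_sum[OF assms(1)])
  also have "\<dots> = fact (fst k) * fact (snd k) * seval (hasse_deriv2 k a) z1 z2 /
      (z1 ^ fst k * z2 ^ snd k)"
    unfolding hasse_deriv2_def seval_weighted sum_distrib_left sum_divide_distrib
    by (intro sum.cong refl) (use assms in \<open>simp add: power_int_diff of_real_gbinomial mult_ac\<close>)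
  finally show ?thesis .
qed

lemma generates_polynomials_iff_hasse_deriv2:
  "generates_polynomials a m \<longleftrightarrow>
    (\<forall>(z1, z2)\<in>E'. \<forall>k. fst k + snd k \<le> m \<longrightarrow> seval (hasse_deriv2 k a) z1 z2 = 0)"
  by (auto simp: generates_polynomials_def E'_def Dk_seval)

section \<open>Uniqueness of coefficients\<close>

lemma power_int_sum_eq_0_imp_coeff_eq_0:
  fixes c :: "'i \<Rightarrow> 'a :: field_char_0" and e :: "'i \<Rightarrow> int"
  assumes "finite S" and inj: "inj_on e S"
    and zero: "\<And>z. z \<noteq> 0 \<Longrightarrow> (\<Sum>i\<in>S. c i * z powi e i) = 0" and "j \<in> S"
  shows "c j = 0"
proof -
  define N where "N = (\<Sum>i\<in>S. \<bar>e i\<bar>) + 1"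
  have pos: "e i + N > 0" if "i \<in> S" for i
    using member_le_sum[of i S "\<lambda>i. \<bar>e i\<bar>"] that assms(1) by (simp add: N_def)
  define P where "P = (\<Sum>i\<in>S. monom (c i) (nat (e i + N)))"
  have "poly P z = 0" for z
  proof (cases "z = 0")
    case True
    then show ?thesis
      using pos by (auto simp: P_def poly_sum poly_monom intro!: sum.neutral)
  next
    case False
    have "poly P z = (\<Sum>i\<in>S. c i * z powi (e i + N))"
      using pos unfolding P_def poly_sum poly_monom
      by (intro sum.cong refl) (auto simp: power_int_def dest: less_imp_le)
    also have "\<dots> = z powi N * (\<Sum>i\<in>S. c i * z powi e i)"
      using False by (simp add: power_int_add sum_distrib_left mult_ac)
    finally show ?thesis
      using zero[OF False] by simp
  qed
  then have "P = 0"
    using poly_all_0_iff_0 by blast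
  moreover have "coeff P (nat (e j + N)) = (\<Sum>i\<in>S. if i = j then c i else 0)"
    unfolding P_def coeff_sum
    by (intro sum.cong refl)
       (use pos \<open>j \<in> S\<close> inj in \<open>auto simp: nat_eq_iff2 inj_on_eq_iff dest: less_imp_le\<close>)
  ultimately show ?thesis
    using assms by simp
qed

text \<open>Kronecker's substitution \<open>z\<^sub>2 = z\<^sub>1^M\<close> reduces the bivariate case to the univariate one.\<close>

lemma symbol_eq_0I:
  assumes zero: "\<And>z1 z2. z1 \<noteq> 0 \<Longrightarrow> z2 \<noteq> 0 \<Longrightarrow> seval a z1 z2 = 0"
  shows "a = 0"
proof -
  let ?K = "Poly_Mapping.keys a"
  define M where "M = 2 * (\<Sum>\<alpha>\<in>?K. \<bar>fst \<alpha>\<bar>) + 1"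
  have bound: "2 * \<bar>fst \<alpha>\<bar> < M" if "\<alpha> \<in> ?K" for \<alpha>
    using member_le_sum[of \<alpha> ?K "\<lambda>\<alpha>. \<bar>fst \<alpha>\<bar>"] that by (simp add: M_def)
  have inj: "inj_on (\<lambda>\<alpha>. fst \<alpha> + M * snd \<alpha>) ?K"
  proof (rule inj_onI)
    fix \<alpha> \<beta> assume "\<alpha> \<in> ?K" "\<beta> \<in> ?K" and eq: "fst \<alpha> + M * snd \<alpha> = fst \<beta> + M * snd \<beta>"
    then have "\<bar>fst \<alpha> - fst \<beta>\<bar> < M"
      using bound[of \<alpha>] bound[of \<beta>] by linarith
    moreover have "M dvd fst \<alpha> - fst \<beta>"
      by (rule dvdI[of _ _ "snd \<beta> - snd \<alpha>"]) (use eq in \<open>simp add: algebra_simps\<close>)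
    ultimately have "fst \<alpha> = fst \<beta>"
      using zdvd_not_zless[of "\<bar>fst \<alpha> - fst \<beta>\<bar>" M] by auto
    then show "\<alpha> = \<beta>"
      using eq bound[OF \<open>\<alpha> \<in> ?K\<close>] by (auto simp: prod_eq_iff)
  qed
  have "(\<Sum>\<alpha>\<in>?K. of_real (coef a \<alpha>) * z powi (fst \<alpha> + M * snd \<alpha>)) = 0" if "z \<noteq> 0" for z :: complex
    using zero[OF that, of "z powi M"] that
    by (simp add: seval_def power_int_add power_int_mult mult.assoc)
  from power_int_sum_eq_0_imp_coeff_eq_0[OF finite_keys inj this]
  have "coef a \<alpha> = 0" for \<alpha>
    by (metis in_keys_iff of_real_eq_0_iff)
  then show ?thesis
    by (intro poly_mapping_eqI) simp
qed

lemma symbol_eqI: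
  assumes "\<And>z1 z2. z1 \<noteq> 0 \<Longrightarrow> z2 \<noteq> 0 \<Longrightarrow> seval a z1 z2 = seval b z1 z2"
  shows "a = b"
  using symbol_eq_0I[of "a - b"] assms by simp

section \<open>Symmetric symbols\<close>

lemma seval_map_key_involution:
  assumes inv: "\<And>\<alpha>. r (r \<alpha>) = \<alpha>"
  shows "seval (Poly_Mapping.map_key r a) z1 z2 =
    (\<Sum>\<alpha>\<in>Poly_Mapping.keys a. of_real (coef a \<alpha>) * z1 powi fst (r \<alpha>) * z2 powi snd (r \<alpha>))"
proof -
  have "inj r"
    by (metis inv injI)
  have "Poly_Mapping.keys (Poly_Mapping.map_key r a) = r ` Poly_Mapping.keys a"
    unfolding keys_map_key[OF \<open>inj r\<close>] by (auto simp: inv image_iff) (metis inv)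
  then show ?thesis
    unfolding seval_def
    by (simp add: sum.reindex inj_on_subset[OF \<open>inj r\<close>] map_key.rep_eq[OF \<open>inj r\<close>] inv)
qed

lemma coef_involution_invariant:
  assumes inv: "\<And>\<alpha>. r (r \<alpha>) = \<alpha>"
    and eq: "\<And>z1 z2. z1 \<noteq> 0 \<Longrightarrow> z2 \<noteq> 0 \<Longrightarrow> seval a z1 z2 =
      (\<Sum>\<alpha>\<in>Poly_Mapping.keys a. of_real (coef a \<alpha>) * z1 powi fst (r \<alpha>) * z2 powi snd (r \<alpha>))"
  shows "coef a (r \<alpha>) = coef a \<alpha>"
proof -
  have "inj r"
    by (metis inv injI)
  have "Poly_Mapping.map_key r a = a"
    by (rule symbol_eqI) (simp add: seval_map_key_involution[OF inv] flip: eq)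
  then show ?thesis
    using map_key.rep_eq[OF \<open>inj r\<close>, of a] by (metis comp_apply)
qed

lemma symmetric_symbol_coef:
  assumes "symmetric_symbol a"
  shows coef_reflect: "coef a (- i, j) = coef a (i, j)"
    and coef_swap: "coef a (j, i) = coef a (i, j)"
proof -
  have sym: "seval a z1 z2 = seval a (1 / z1) z2" "seval a z1 z2 = seval a z2 z1"
    if "z1 \<noteq> 0" "z2 \<noteq> 0" for z1 z2
    using assms that unfolding symmetric_symbol_def by blast+
  have "coef a (map_prod uminus id (i, j)) = coef a (i, j)"
  proof (rule coef_involution_invariant)
    fix z1 z2 :: complex
    assume "z1 \<noteq> 0" "z2 \<noteq> 0"
    then show "seval a z1 z2 = (\<Sum>\<alpha>\<in>Poly_Mapping.keys a. of_real (coef a \<alpha>) *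
        z1 powi fst (map_prod uminus id \<alpha>) * z2 powi snd (map_prod uminus id \<alpha>))"
      by (subst sym(1)) (auto simp: seval_def power_int_minus divide_inverse power_int_inverse)
  qed auto
  then show "coef a (- i, j) = coef a (i, j)"
    by simp
  have "coef a (prod.swap (i, j)) = coef a (i, j)"
  proof (rule coef_involution_invariant)
    fix z1 z2 :: complex
    assume "z1 \<noteq> 0" "z2 \<noteq> 0"
    then show "seval a z1 z2 = (\<Sum>\<alpha>\<in>Poly_Mapping.keys a. of_real (coef a \<alpha>) *
        z1 powi fst (prod.swap \<alpha>) * z2 powi snd (prod.swap \<alpha>))"
      by (subst sym(2)) (auto simp: seval_def mult_ac)
  qed auto
  then show "coef a (j, i) = coef a (i, j)"
    by simp
qed

lemma seval_hasse_deriv2_swap: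
  assumes "symmetric_symbol a"
  shows "seval (hasse_deriv2 (k, l) a) z1 z2 = seval (hasse_deriv2 (l, k) a) z2 z1"
proof -
  have "hasse_deriv2 (k, l) a = Poly_Mapping.map_key prod.swap (hasse_deriv2 (l, k) a)"
    by (rule poly_mapping_eqI) (auto simp: hasse_deriv2_def map_key.rep_eq coef_swap[OF assms])
  then show ?thesis
    by (simp add: seval_map_key_involution) (simp add: seval_def mult_ac)
qed

lemma symmetric_generates_polynomialsI:
  assumes sym: "symmetric_symbol a"
    and zero: "\<And>k l z. k + l \<le> m \<Longrightarrow> z \<in> {1, - 1} \<Longrightarrow> seval (hasse_deriv2 (k, l) a) (- 1) z = 0"
  shows "generates_polynomials a m"
proof -
  have "seval (hasse_deriv2 (k, l) a) z (- 1) = 0" if "k + l \<le> m" "z \<in> {1, - 1}" for k l z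
    using zero[of l k z] that by (simp add: seval_hasse_deriv2_swap[OF sym, of k l] add.commute)
  then show ?thesis
    using zero by (auto simp: generates_polynomials_iff_hasse_deriv2 E'_def)
qed

section \<open>Interpolatory symbols\<close>

abbreviation sign_sum :: "symbol \<Rightarrow> complex \<Rightarrow> complex \<Rightarrow> complex"
  where "sign_sum a z1 z2 \<equiv>
    seval a z1 z2 + seval a z1 (- z2) + seval a (- z1) z2 + seval a (- z1) (- z2)"

lemma seval_weighted_parity:
  "seval (weighted (\<lambda>\<alpha>. (1 + s * (- 1) powi fst \<alpha>) * (1 + t * (- 1) powi snd \<alpha>)) a) z1 z2 =
    seval a z1 z2 + of_real t * seval a z1 (- z2) + of_real s * seval a (- z1) z2 +
    of_real (s * t) * seval a (- z1) (- z2)"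
  unfolding seval_weighted unfolding seval_def sum_distrib_left sum.distrib[symmetric]
  by (intro sum.cong refl) (auto simp: power_int_minus_left algebra_simps)

lemma interpolatory_sign_sum_weighted:
  assumes "interpolatory a"
  shows "sign_sum (weighted g a) 1 1 = of_real (4 * g (0, 0))"
proof -
  let ?parity = "\<lambda>\<alpha> :: int \<times> int. (1 + (- 1) powi fst \<alpha>) * (1 + (- 1) powi snd \<alpha>) :: real"
  have four: "weighted ?parity a = Poly_Mapping.single (0, 0) 4"
    using assms seval_weighted_parity[of 1 1 a]
    by (intro symbol_eqI) (simp add: interpolatory_def)
  have "weighted ?parity (weighted g a) = weighted g (weighted ?parity a)"
    by (simp add: weighted_weighted mult.commute)
  then show ?thesis
    using seval_weighted_parity[of 1 1 "weighted g a" 1 1]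
    by (simp add: four weighted_single mult.commute)
qed

lemma interpolatory_generates_imp_reproduces:
  assumes "interpolatory a" "generates_polynomials a m"
  shows "reproduces_polynomials a m"
proof -
  have at_1: "seval (hasse_deriv2 k a) 1 1 = of_real (4 * ((0 gchoose fst k) * (0 gchoose snd k)))"
    if "fst k + snd k \<le> m" for k
  proof -
    have "sign_sum (hasse_deriv2 k a) 1 1 = of_real (4 * ((0 gchoose fst k) * (0 gchoose snd k)))"
      unfolding hasse_deriv2_def by (subst interpolatory_sign_sum_weighted[OF assms(1)]) simp
    moreover have "seval (hasse_deriv2 k a) 1 (- 1) = 0" "seval (hasse_deriv2 k a) (- 1) 1 = 0"
      "seval (hasse_deriv2 k a) (- 1) (- 1) = 0"
      using assms(2) that by (cases k; simp add: generates_polynomials_iff_hasse_deriv2 E'_def)+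
    ultimately show ?thesis
      by simp
  qed
  have "seval a 1 1 = 4"
    using at_1[of "(0, 0)"] by simp
  moreover have "Dk k (seval a) 1 1 = 0" if "0 < fst k + snd k" "fst k + snd k \<le> m" for k
    using at_1[OF that(2)] that(1) by (auto simp: Dk_seval gbinomial_0_left)
  ultimately show ?thesis
    using assms(2) by (auto simp: reproduces_polynomials_def)
qed

section \<open>Lower bound for the support\<close>

lemma seval_weighted_poly_eq_0:
  assumes zero: "\<And>k. k \<le> m \<Longrightarrow> seval (hasse_deriv2 (k, 0) a) z1 z2 = 0" and "degree q \<le> m"
  shows "seval (weighted (\<lambda>\<alpha>. poly q (of_int (fst \<alpha>))) a) z1 z2 = 0"
proof -
  let ?W = "\<lambda>k q. seval (weighted (\<lambda>\<alpha>.
    (of_int (fst \<alpha>) gchoose k) * poly q (of_int (fst \<alpha>))) a) z1 z2"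
  have "?W k q = 0" if "k + degree q \<le> m" for k
    using that
  proof (induction q arbitrary: k)
    case 0
    then show ?case by (simp add: seval_weighted)
  next
    case (pCons c q)
    have "?W k (pCons c q) = of_real c * seval (hasse_deriv2 (k, 0) a) z1 z2 +
        of_nat k * ?W k q + of_nat (Suc k) * ?W (Suc k) q"
    proof -
      have "(x gchoose k) * poly (pCons c q) x = c * (x gchoose k) +
          real k * ((x gchoose k) * poly q x) + real (Suc k) * ((x gchoose Suc k) * poly q x)" for x
        using arg_cong[OF gbinomial_mult_1'[of x k], of "\<lambda>y. y * poly q x"]
        by (simp add: algebra_simps)
      then show ?thesis
        unfolding hasse_deriv2_def seval_weighted sum_distrib_left sum.distrib[symmetric]
        by (intro sum.cong refl) (simp add: algebra_simps)
    qed
    moreover have "?W k q = 0 \<and> ?W (Suc k) q = 0"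
    proof (cases "q = 0")
      case True
      then show ?thesis by (simp add: seval_weighted)
    next
      case False
      then show ?thesis
        using pCons.IH[of k] pCons.IH[of "Suc k"] pCons.prems by simp
    qed
    ultimately show ?case
      using zero[of k] pCons.prems by simp
  qed
  from this[of 0] show ?thesis
    using assms(2) by simp
qed

lemma odd_part_quadrature:
  assumes "interpolatory a" "generates_polynomials a m" "degree q \<le> m"
  shows "seval (weighted (\<lambda>\<alpha>. (1 - (- 1) powi fst \<alpha>) * (1 - (- 1) powi snd \<alpha>) *
    poly q (of_int (fst \<alpha>))) a) 1 1 = of_real (4 * poly q 0)"
proof -
  define b where "b = weighted (\<lambda>\<alpha>. poly q (of_int (fst \<alpha>))) a"
  have zero: "seval b 1 (- 1) = 0" "seval b (- 1) 1 = 0" "seval b (- 1) (- 1) = 0"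
    unfolding b_def using assms(2)
    by (auto simp: generates_polynomials_iff_hasse_deriv2 E'_def
        intro!: seval_weighted_poly_eq_0[OF _ assms(3)])
  have "seval (weighted (\<lambda>\<alpha>. (1 - (- 1) powi fst \<alpha>) * (1 - (- 1) powi snd \<alpha>)) b) 1 1 = seval b 1 1"
    using seval_weighted_parity[of "- 1" "- 1" b 1 1] zero by simp
  also have "\<dots> = of_real (4 * poly q 0)"
    using interpolatory_sign_sum_weighted[OF assms(1), of "\<lambda>\<alpha>. poly q (of_int (fst \<alpha>))"] zero
    by (simp add: b_def)
  finally show ?thesis
    by (simp only: b_def weighted_weighted)
qed

definition odd_roots_poly :: "nat \<Rightarrow> real poly"
  where "odd_roots_poly m = (\<Prod>i<m. [:- (2 * real i + 1)\<^sup>2, 0, 1:])"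

lemma degree_odd_roots_poly: "degree (odd_roots_poly m) \<le> 2 * m"
  using degree_prod_sum_le[of "{..<m}" "\<lambda>i. [:- (2 * real i + 1)\<^sup>2, 0, 1:]"]
  by (simp add: odd_roots_poly_def o_def mult.commute)

lemma poly_odd_roots_poly: "poly (odd_roots_poly m) x = (\<Prod>i<m. x\<^sup>2 - (2 * real i + 1)\<^sup>2)"
  by (simp add: odd_roots_poly_def poly_prod power2_eq_square)

lemma poly_odd_roots_poly_eq_0:
  fixes i :: int
  assumes "odd i" "\<bar>i\<bar> < 2 * int m + 1"
  shows "poly (odd_roots_poly m) (of_int i) = 0"
proof -
  obtain t where "\<bar>i\<bar> = 2 * t + 1"
    using assms(1) by (metis dvd_abs_iff oddE)
  then have "nat t < m" "\<bar>real_of_int i\<bar> = 2 * real (nat t) + 1"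
    using assms(2) by linarith+
  then have "(real_of_int i)\<^sup>2 - (2 * real (nat t) + 1)\<^sup>2 = 0"
    by (metis power2_abs right_minus_eq)
  with \<open>nat t < m\<close> show ?thesis
    by (auto simp: poly_odd_roots_poly intro!: bexI[of _ "nat t"])
qed

lemma interpolatory_large_odd_exponent:
  assumes "interpolatory a" "generates_polynomials a (2 * m)"
  obtains i j where "coef a (i, j) \<noteq> 0" "2 * int m + 1 \<le> \<bar>i\<bar>" "odd j"
proof -
  let ?b = "weighted (\<lambda>\<alpha>. (1 - (- 1) powi fst \<alpha>) * (1 - (- 1) powi snd \<alpha>) *
    poly (odd_roots_poly m) (of_int (fst \<alpha>))) a"
  have "poly (odd_roots_poly m) 0 \<noteq> 0"
    by (auto simp: poly_odd_roots_poly add_eq_0_iff)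
  then have "seval ?b 1 1 \<noteq> 0"
    unfolding odd_part_quadrature[OF assms degree_odd_roots_poly] by simp
  then have "?b \<noteq> 0"
    by (metis seval_0)
  then obtain i j where "coef ?b (i, j) \<noteq> 0"
    by (auto simp: poly_mapping_eq_iff fun_eq_iff)
  then have nz: "coef a (i, j) \<noteq> 0" "poly (odd_roots_poly m) (of_int i) \<noteq> 0"
    and odd: "odd i" "odd j"
    by (auto simp: power_int_minus_left split: if_splits)
  have "2 * int m + 1 \<le> \<bar>i\<bar>"
    using poly_odd_roots_poly_eq_0[OF odd(1)] nz(2) by (meson not_less)
  with nz(1) odd(2) show ?thesis
    using that by blast
qed

lemma coef_in_symbol_support:
  "coef a (i, j) \<noteq> 0 \<Longrightarrow> (real_of_int i, real_of_int j) \<in> symbol_support a"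
  unfolding symbol_support_def by (auto intro!: hull_inc)

lemma convex_symbol_support: "convex (symbol_support a)"
  by (simp add: symbol_support_def)

lemma symbol_support_subset:
  assumes "convex C" "\<And>i j. coef a (i, j) \<noteq> 0 \<Longrightarrow> (real_of_int i, real_of_int j) \<in> C"
  shows "symbol_support a \<subseteq> C"
  unfolding symbol_support_def using assms by (intro hull_minimal) auto

lemma compact_symbol_support: "compact (symbol_support a)"
proof -
  have "{(real_of_int i, real_of_int j) | i j. coef a (i, j) \<noteq> 0} =
      map_prod real_of_int real_of_int ` Poly_Mapping.keys a"
    by (force simp: in_keys_iff)
  then show ?thesis
    unfolding symbol_support_def by (simp add: finite_imp_compact_convex_hull)
qed

lemma support_size_mono:
  assumes "symbol_support a \<subseteq> symbol_support b"
  shows "support_size a \<le> support_size b"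
  unfolding support_size_def using assms compact_symbol_support
  by (intro measure_mono_fmeasurable) (auto intro: fmeasurable_compact borel_compact)

lemma symmetric_symbol_support:
  assumes sym: "symmetric_symbol a" and "(x, y) \<in> symbol_support a"
  shows symbol_support_reflect: "(- x, y) \<in> symbol_support a"
    and symbol_support_swap: "(y, x) \<in> symbol_support a"
proof -
  have image: "f (x, y) \<in> symbol_support a"
    if "linear f" "\<And>i j. coef a (i, j) \<noteq> 0 \<Longrightarrow> f (real_of_int i, real_of_int j) \<in> symbol_support a"
    for f
    using symbol_support_subset[OF convex_linear_vimage[OF that(1) convex_symbol_support], of a a]
      that(2) assms(2) by auto
  have "linear (map_prod uminus id :: real \<times> real \<Rightarrow> real \<times> real)"
    by (rule linearI) (auto simp: map_prod_def split_beta)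
  moreover have "map_prod uminus id (real_of_int i, real_of_int j) \<in> symbol_support a"
    if "coef a (i, j) \<noteq> 0" for i j
    using coef_in_symbol_support[of a "- i" j] that by (simp add: coef_reflect[OF sym])
  ultimately show "(- x, y) \<in> symbol_support a"
    using image by fastforce
  have "linear (prod.swap :: real \<times> real \<Rightarrow> real \<times> real)"
    by (rule linearI) auto
  moreover have "prod.swap (real_of_int i, real_of_int j) \<in> symbol_support a"
    if "coef a (i, j) \<noteq> 0" for i j
    using coef_in_symbol_support[of a j i] that by (simp add: coef_swap[OF sym, of j i])
  ultimately show "(y, x) \<in> symbol_support a"
    using image by fastforce
qed

lemma convex_reflection_rectangle:
  fixes C :: "(real \<times> real) set"
  assumes "convex C"
    and reflect: "\<And>x y. (x, y) \<in> C \<Longrightarrow> (- x, y) \<in> C" "\<And>x y. (x, y) \<in> C \<Longrightarrow> (x, - y) \<in> C"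
    and "(x, y) \<in> C" "\<bar>x'\<bar> \<le> \<bar>x\<bar>" "\<bar>y'\<bar> \<le> \<bar>y\<bar>"
  shows "(x', y') \<in> C"
proof -
  have scale: "\<exists>s. \<bar>s\<bar> \<le> 1 \<and> u' = s * u" if "\<bar>u'\<bar> \<le> \<bar>u\<bar>" for u u' :: real
    using that by (cases "u = 0") (auto intro!: exI[of _ "u' / u"])
  obtain s t where s: "\<bar>s\<bar> \<le> 1" "x' = s * x" and t: "\<bar>t\<bar> \<le> 1" "y' = t * y"
    using scale assms(5,6) by metis
  have "((1 + s) / 2) *\<^sub>R (x, y) + ((1 - s) / 2) *\<^sub>R (- x, y) \<in> C"
    using assms(4) reflect s by (intro convexD[OF assms(1)]) (auto simp: field_simps)
  then have "(x', y) \<in> C"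
    using s by (simp add: field_simps)
  then have "((1 + t) / 2) *\<^sub>R (x', y) + ((1 - t) / 2) *\<^sub>R (x', - y) \<in> C"
    using reflect t by (intro convexD[OF assms(1)]) (auto simp: field_simps)
  then show ?thesis
    using t by (simp add: field_simps)
qed

definition octagon :: "real \<Rightarrow> (real \<times> real) set"
  where "octagon d = {(x, y). \<bar>x\<bar> \<le> d \<and> \<bar>y\<bar> \<le> d \<and> \<bar>x\<bar> + \<bar>y\<bar> \<le> d + 1}"

lemma convex_antidiagonal_segment:
  fixes C :: "(real \<times> real) set"
  assumes "convex C" "(p, q) \<in> C" "(q, p) \<in> C" "q \<le> u" "u \<le> p"
  shows "(u, p + q - u) \<in> C"
proof (cases "p = q")
  case True
  with assms show ?thesis by simp
next
  case False
  define t where "t = (u - q) / (p - q)"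
  have t: "0 \<le> t" "t \<le> 1" "t * (p - q) = u - q"
    using assms(4,5) False by (auto simp: t_def field_simps)
  have "t *\<^sub>R (p, q) + (1 - t) *\<^sub>R (q, p) \<in> C"
    using assms t by (intro convexD) auto
  moreover have "t *\<^sub>R (p, q) + (1 - t) *\<^sub>R (q, p) = (u, p + q - u)"
    using t(3) by (simp add: algebra_simps)
  ultimately show ?thesis
    by (simp only:)
qed

lemma octagon_subset_symmetric_convex:
  assumes "convex C" and reflect: "\<And>x y. (x, y) \<in> C \<Longrightarrow> (- x, y) \<in> C"
    and swap: "\<And>x y. (x, y) \<in> C \<Longrightarrow> (y, x) \<in> C"
    and "(p, q) \<in> C" "d \<le> \<bar>p\<bar>" "1 \<le> \<bar>q\<bar>" "1 \<le> d"
  shows "octagon d \<subseteq> C"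
proof clarify
  fix x y assume xy: "(x, y) \<in> octagon d"
  have reflect_snd: "(x, - y) \<in> C" if "(x, y) \<in> C" for x y
    using swap[OF reflect[OF swap[OF that]]] .
  have rectangle: "(x', y') \<in> C" if "(x, y) \<in> C" "\<bar>x'\<bar> \<le> \<bar>x\<bar>" "\<bar>y'\<bar> \<le> \<bar>y\<bar>" for x y x' y'
    using assms(1) reflect reflect_snd that by (rule convex_reflection_rectangle)
  have vertex: "(d, 1) \<in> C"
    using assms(5-7) by (intro rectangle[OF assms(4)]) auto
  define u where "u = max 1 \<bar>x\<bar>"
  have "1 \<le> u" "u \<le> d"
    using xy \<open>1 \<le> d\<close> by (auto simp: u_def octagon_def)
  with assms(1) vertex swap[OF vertex] have "(u, d + 1 - u) \<in> C"
    by (rule convex_antidiagonal_segment)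
  moreover have "\<bar>x\<bar> \<le> \<bar>u\<bar>" "\<bar>y\<bar> \<le> \<bar>d + 1 - u\<bar>"
    using xy unfolding u_def octagon_def by auto
  ultimately show "(x, y) \<in> C"
    by (rule rectangle)
qed

lemma octagon_subset_symbol_support:
  assumes "symmetric_symbol a" "interpolatory a" "generates_polynomials a (2 * m)"
  shows "octagon (2 * real m + 1) \<subseteq> symbol_support a"
proof -
  obtain i j where ij: "coef a (i, j) \<noteq> 0" "2 * int m + 1 \<le> \<bar>i\<bar>" "odd j"
    using interpolatory_large_odd_exponent[OF assms(2,3)] .
  have "j \<noteq> 0"
    using ij(3) by auto
  then have "2 * real m + 1 \<le> \<bar>real_of_int i\<bar>" "1 \<le> \<bar>real_of_int j\<bar>"
    using ij(2) by linarith+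
  then show ?thesis
    using coef_in_symbol_support[OF ij(1)] symmetric_symbol_support[OF assms(1)]
    by (intro octagon_subset_symmetric_convex[OF convex_symbol_support]) auto
qed

section \<open>The Bezout identity of maximally flat half-band filters\<close>

definition halfband :: "nat \<Rightarrow> 'a :: comm_semiring_1 \<Rightarrow> 'a \<Rightarrow> 'a"
  where "halfband r x y = x ^ Suc r * (\<Sum>i\<le>r. of_nat ((r + i) choose i) * y ^ i)"

lemma sum_binomial_mult_one_minus:
  fixes y :: "'a :: comm_ring_1"
  shows "(1 - y) * (\<Sum>i\<le>m. of_nat ((Suc n + i) choose i) * y ^ i) =
    (\<Sum>i\<le>m. of_nat ((n + i) choose i) * y ^ i) - of_nat ((Suc n + m) choose m) * y ^ Suc m"
proof (induction m)
  case (Suc m)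
  have "of_nat ((Suc n + Suc m) choose Suc m) =
      (of_nat ((Suc n + m) choose m) + of_nat ((n + Suc m) choose Suc m) :: 'a)"
    by simp
  with Suc.IH show ?case
    by (simp only: sum.atMost_Suc distrib_left) (simp add: algebra_simps)
qed simp

lemma central_binomial_Suc: "(2 * Suc r) choose Suc r = 2 * (Suc (2 * r) choose Suc r)"
  using binomial_symmetric[of r "Suc (2 * r)"] by simp

lemma halfband_Suc_diff:
  fixes x y :: "'a :: comm_ring_1"
  assumes "x + y = 1"
  shows "halfband (Suc r) x y - halfband r x y =
    of_nat (Suc (2 * r) choose Suc r) * (x * y) ^ Suc r * (x - y)"
proof -
  let ?c = "of_nat (Suc (2 * r) choose Suc r) :: 'a"
  let ?S = "\<Sum>i\<le>r. of_nat ((r + i) choose i) * y ^ i"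
  have x: "x = 1 - y"
    using assms by (simp add: eq_diff_eq)
  have "of_nat ((Suc r + Suc r) choose Suc r) = 2 * ?c"
    using arg_cong[OF central_binomial_Suc[of r], of "of_nat :: nat \<Rightarrow> 'a"] by (simp flip: mult_2)
  then have "x * (\<Sum>i\<le>Suc r. of_nat ((Suc r + i) choose i) * y ^ i) =
      ?S + ?c * y ^ Suc r - 2 * ?c * y ^ Suc (Suc r)"
    unfolding x sum_binomial_mult_one_minus
    by (simp only: sum.atMost_Suc add_Suc_right flip: mult_2)
  also have "\<dots> = ?S + ?c * y ^ Suc r * (x - y)"
    by (simp add: x algebra_simps)
  finally have "x ^ Suc r * (x * (\<Sum>i\<le>Suc r. of_nat ((Suc r + i) choose i) * y ^ i)) =
      x ^ Suc r * (?S + ?c * y ^ Suc r * (x - y))"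
    by (rule arg_cong)
  moreover have "halfband (Suc r) x y =
      x ^ Suc r * (x * (\<Sum>i\<le>Suc r. of_nat ((Suc r + i) choose i) * y ^ i))"
    unfolding halfband_def by (simp only: power_Suc2[of x "Suc r"] mult.assoc)
  moreover have "halfband r x y = x ^ Suc r * ?S"
    by (simp only: halfband_def)
  ultimately show ?thesis
    by (simp only: power_mult_distrib) (simp only: algebra_simps)
qed

lemma halfband_add_swap:
  fixes x y :: "'a :: comm_ring_1"
  assumes "x + y = 1"
  shows "halfband r x y + halfband r y x = 1"
proof (induction r)
  case 0
  then show ?case using assms by (simp add: halfband_def)
next
  case (Suc r)
  have "y + x = 1"
    using assms by (simp add: add.commute)
  note step = halfband_Suc_diff[OF assms, of r] halfband_Suc_diff[OF this, of r]
  have "(halfband (Suc r) x y - halfband r x y) + (halfband (Suc r) y x - halfband r y x) = 0"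
    unfolding step by (simp add: mult.commute[of y x] algebra_simps)
  with Suc show ?case
    by (simp add: algebra_simps)
qed

section \<open>Symbols of the Dubuc--Deslauriers schemes\<close>

definition dubuc_deslauriers :: "nat \<Rightarrow> laurent"
  where "dubuc_deslauriers r = pseudo_spline (Suc r) r"

lemma dubuc_deslauriers_eq_halfband: "dubuc_deslauriers r = 2 * halfband r sigma delta"
  by (simp add: dubuc_deslauriers_def pseudo_spline_def halfband_def atMost_atLeast0 mult.assoc)

lemma sigma_plus_delta: "sigma + delta = 1"
proof -
  let ?w = "Poly_Mapping.single (- 1) (1 / 4) :: laurent"
  have "sigma + delta = Z * ?w + Z * ?w + Z * ?w + Z * ?w"
    by (simp add: sigma_def delta_def power2_eq_square algebra_simps)
  also have "\<dots> = 1"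
    by (simp add: Z_def mult_single flip: single_add)
  finally show ?thesis .
qed

lemma dubuc_deslauriers_Suc_diff:
  "dubuc_deslauriers (Suc r) - dubuc_deslauriers r =
    2 * of_nat (Suc (2 * r) choose Suc r) * (sigma * delta) ^ Suc r * (sigma - delta)"
  unfolding dubuc_deslauriers_eq_halfband right_diff_distrib[symmetric]
    halfband_Suc_diff[OF sigma_plus_delta] by (simp only: mult.assoc)

lemma leval_dubuc_deslauriers:
  "z \<noteq> 0 \<Longrightarrow> leval (dubuc_deslauriers r) z = 2 * halfband r (leval sigma z) (leval delta z)"
  unfolding dubuc_deslauriers_eq_halfband halfband_def
  by (simp only: leval_mult leval_power leval_sum leval_of_nat leval_numeral not_False_eq_True)

lemma leval_dubuc_deslauriers_inverse:
  assumes "z \<noteq> 0"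
  shows "leval (dubuc_deslauriers r) (1 / z) = leval (dubuc_deslauriers r) z"
proof -
  have "leval sigma (1 / z) = leval sigma z" "leval delta (1 / z) = leval delta z"
    using assms by (simp_all add: leval_sigma leval_delta field_simps power2_eq_square)
  then show ?thesis
    using assms by (simp add: leval_dubuc_deslauriers)
qed

lemma leval_dubuc_deslauriers_minus:
  assumes "z \<noteq> 0"
  shows "leval (dubuc_deslauriers r) z + leval (dubuc_deslauriers r) (- z) = 2"
proof -
  have "leval sigma z + leval delta z = 1"
    by (metis leval_1 leval_add sigma_plus_delta)
  then have "halfband r (leval sigma z) (leval delta z) +
      halfband r (leval delta z) (leval sigma z) = 1"
    by (rule halfband_add_swap)
  moreover have "leval sigma (- z) = leval delta z" "leval delta (- z) = leval sigma z"
    using assms by (simp_all add: leval_sigma leval_delta)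
  ultimately show ?thesis
    using assms by (simp add: leval_dubuc_deslauriers flip: distrib_left)
qed

lemma weighted_single_mult:
  fixes p :: laurent
  shows "weighted g (Poly_Mapping.single j c * p) =
    Poly_Mapping.single j c * weighted (\<lambda>i. g (j + i)) p"
proof -
  have "Poly_Mapping.single j c * p =
      (\<Sum>i\<in>Poly_Mapping.keys p. Poly_Mapping.single (j + i) (c * coef p i))"
    by (subst laurent_expand[of p]) (simp add: sum_distrib_left mult_single)
  moreover have "weighted (\<lambda>i. g (j + i)) p =
      (\<Sum>i\<in>Poly_Mapping.keys p. Poly_Mapping.single i (g (j + i) * coef p i))"
    by (subst laurent_expand[of p]) (simp only: weighted_sum weighted_single)
  ultimately show ?thesis
    by (simp add: weighted_sum weighted_single sum_distrib_left mult_single mult.left_commute)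
qed

abbreviation linear_factor :: "real \<Rightarrow> laurent"
  where "linear_factor c \<equiv> Poly_Mapping.single 0 c - Z"

lemma leval_hasse_deriv_linear_factor_mult:
  assumes "c \<noteq> 0"
  shows "leval (hasse_deriv k (linear_factor c * p)) (of_real c) =
    (if k = 0 then 0 else - of_real c * leval (hasse_deriv (k - 1) p) (of_real c))"
proof -
  have diff: "leval (hasse_deriv k (linear_factor c * p)) (of_real c) =
      of_real c *
        leval (weighted (\<lambda>i. (of_int i gchoose k) - (of_int (1 + i) gchoose k)) p) (of_real c)"
    using assms unfolding hasse_deriv_def Z_def left_diff_distrib weighted_diff weighted_single_mult
    by (simp add: leval_weighted algebra_simps sum_subtractf)
  show ?thesis
  proof (cases k)
    case 0
    then show ?thesis
      using diff by (simp add: leval_weighted)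
  next
    case (Suc l)
    have "(of_int i gchoose k) - (of_int (1 + i) gchoose k) = - (real_of_int i gchoose l)" for i
      using gbinomial_Suc_Suc[of "real_of_int i" l] by (simp add: Suc add.commute)
    then show ?thesis
      using diff by (simp add: Suc hasse_deriv_def leval_weighted sum_negf)
  qed
qed

lemma linear_factor_power_dvd_imp_hasse_deriv_eq_0:
  assumes "c \<noteq> 0" "linear_factor c ^ s dvd p" "k < s"
  shows "leval (hasse_deriv k p) (of_real c) = 0"
  using assms(2,3)
proof (induction s arbitrary: p k)
  case (Suc s)
  then obtain q where p: "p = linear_factor c * (linear_factor c ^ s * q)"
    by (auto simp: dvd_def mult.assoc)
  show ?case
    unfolding p leval_hasse_deriv_linear_factor_mult[OF assms(1)]
    using Suc.IH[of _ "k - 1"] Suc.prems(2) by auto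
qed simp

lemma sigma_power_dvd_imp_hasse_deriv_eq_0:
  assumes "sigma ^ r dvd p" "k < 2 * r"
  shows "leval (hasse_deriv k p) (- 1) = 0"
proof -
  have "linear_factor (- 1) = - (1 + Z)"
    by (simp add: single_uminus)
  then have "(linear_factor (- 1))\<^sup>2 dvd sigma"
    by (simp only: power2_minus sigma_def dvd_triv_left)
  then have "linear_factor (- 1) ^ (2 * r) dvd sigma ^ r"
    unfolding power_mult by (rule dvd_power_same)
  from dvd_trans[OF this assms(1)] show ?thesis
    using linear_factor_power_dvd_imp_hasse_deriv_eq_0[of "- 1"] assms(2) by simp
qed

lemma delta_power_dvd_imp_hasse_deriv_eq_0:
  assumes "delta ^ r dvd p" "k < 2 * r"
  shows "leval (hasse_deriv k p) 1 = 0"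
proof -
  have "(linear_factor 1)\<^sup>2 dvd delta"
    by (simp add: delta_def)
  then have "linear_factor 1 ^ (2 * r) dvd delta ^ r"
    unfolding power_mult by (rule dvd_power_same)
  from dvd_trans[OF this assms(1)] show ?thesis
    using linear_factor_power_dvd_imp_hasse_deriv_eq_0[of 1] assms(2) by simp
qed

lemma hasse_deriv_dubuc_deslauriers_eq_0:
  assumes "k < 2 * Suc r"
  shows "leval (hasse_deriv k (dubuc_deslauriers r)) (- 1) = 0"
  by (rule sigma_power_dvd_imp_hasse_deriv_eq_0[OF _ assms])
     (simp add: dubuc_deslauriers_eq_halfband halfband_def dvd_mult)

lemma hasse_deriv_dubuc_deslauriers_Suc_diff_eq_0:
  assumes "k < 2 * Suc r" "z \<in> {1, - 1}"
  shows "leval (hasse_deriv k (dubuc_deslauriers (Suc r) - dubuc_deslauriers r)) z = 0"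
proof -
  have "sigma ^ Suc r dvd dubuc_deslauriers (Suc r) - dubuc_deslauriers r"
    "delta ^ Suc r dvd dubuc_deslauriers (Suc r) - dubuc_deslauriers r"
    unfolding dubuc_deslauriers_Suc_diff power_mult_distrib
    by (rule dvd_mult2[OF dvd_mult[OF dvd_triv_left]] dvd_mult2[OF dvd_mult[OF dvd_triv_right]])+
  then show ?thesis
    using assms sigma_power_dvd_imp_hasse_deriv_eq_0 delta_power_dvd_imp_hasse_deriv_eq_0 by blast
qed

lemma keys_mult_interval:
  fixes p q :: laurent
  assumes "Poly_Mapping.keys p \<subseteq> {a..b}" "Poly_Mapping.keys q \<subseteq> {c..d}"
  shows "Poly_Mapping.keys (p * q) \<subseteq> {a + c..b + d}"
  using keys_mult[of p q] assms by fastforce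

lemma keys_power_interval:
  fixes p :: laurent
  assumes "Poly_Mapping.keys p \<subseteq> {a..b}"
  shows "Poly_Mapping.keys (p ^ k) \<subseteq> {int k * a..int k * b}"
proof (induction k)
  case (Suc k)
  then show ?case
    using keys_mult_interval[OF assms Suc] by (simp add: algebra_simps)
qed simp

lemma keys_of_nat_interval: "Poly_Mapping.keys (of_nat n :: laurent) \<subseteq> {0..0}"
  by (auto simp: in_keys_iff lookup_of_nat when_def split: if_splits)

lemma keys_sigma: "Poly_Mapping.keys sigma \<subseteq> {- 1..1}"
  and keys_delta: "Poly_Mapping.keys delta \<subseteq> {- 1..1}"
proof -
  have "Poly_Mapping.keys (1 + Z) \<subseteq> {0..1}" "Poly_Mapping.keys (1 - Z) \<subseteq> {0..1}"
    using keys_add[of 1 Z] keys_diff[of 1 Z] by (auto simp: Z_def)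
  note square = this[THEN keys_power_interval, of 2]
  have quarter: "Poly_Mapping.keys (Poly_Mapping.single (- 1) (1 / 4) :: laurent) \<subseteq> {- 1..- 1}"
    by simp
  from keys_mult_interval[OF square(1) quarter] keys_mult_interval[OF square(2) quarter]
  show "Poly_Mapping.keys sigma \<subseteq> {- 1..1}" "Poly_Mapping.keys delta \<subseteq> {- 1..1}"
    by (simp_all add: sigma_def delta_def)
qed

lemma keys_dubuc_deslauriers:
  "Poly_Mapping.keys (dubuc_deslauriers r) \<subseteq> {- (2 * int r + 1)..2 * int r + 1}"
proof -
  have "Poly_Mapping.keys (of_nat ((r + i) choose i) * delta ^ i) \<subseteq> {- int r..int r}"
    if "i \<le> r" for i
    using keys_mult_interval[OF keys_of_nat_interval keys_power_interval[OF keys_delta, of i]] that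
    by fastforce
  then have "Poly_Mapping.keys (\<Sum>i\<le>r. of_nat ((r + i) choose i) * delta ^ i) \<subseteq> {- int r..int r}"
    by (intro order.trans[OF keys_sum] UN_least) simp
  from keys_mult_interval[OF keys_power_interval[OF keys_sigma, of "Suc r"] this]
  have "Poly_Mapping.keys (halfband r sigma delta) \<subseteq> {- (2 * int r + 1)..2 * int r + 1}"
    by (simp add: halfband_def algebra_simps)
  from keys_mult_interval[OF keys_of_nat_interval[of 2] this] show ?thesis
    by (simp add: dubuc_deslauriers_eq_halfband)
qed

section \<open>The symbols \<open>a_hat n\<close>\<close>

definition dd_convolution :: "nat \<Rightarrow> symbol"
  where "dd_convolution m =
    (\<Sum>i<m. tensor (dubuc_deslauriers (m - Suc i)) (dubuc_deslauriers i))"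

lemma a_hat_eq_convolution: "a_hat n = dd_convolution n - dd_convolution (n - 1)"
proof -
  have "pseudo_spline (n - i) (n - i - 1) = dubuc_deslauriers (n - Suc i)" if "i < n" for i n
    using that by (simp add: dubuc_deslauriers_def flip: Suc_diff_Suc)
  from this[of _ n] this[of _ "n - 1"] show ?thesis
    unfolding a_hat_def dd_convolution_def
    by (intro arg_cong2[of _ _ _ _ minus] sum.cong)
       (auto simp: dubuc_deslauriers_def numeral_2_eq_2 diff_commute)
qed

lemma seval_dd_convolution:
  "seval (dd_convolution m) z1 z2 =
    (\<Sum>i<m. leval (dubuc_deslauriers (m - Suc i)) z1 * leval (dubuc_deslauriers i) z2)"
  by (simp add: dd_convolution_def seval_tensor)

lemma seval_dd_convolution_swap:
  "seval (dd_convolution m) z1 z2 = seval (dd_convolution m) z2 z1"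
proof -
  let ?f = "\<lambda>i. leval (dubuc_deslauriers (m - Suc i)) z2 * leval (dubuc_deslauriers i) z1"
  have "seval (dd_convolution m) z1 z2 = (\<Sum>i<m. ?f (m - Suc i))"
    unfolding seval_dd_convolution by (intro sum.cong refl) (simp add: Suc_diff_Suc)
  also have "\<dots> = (\<Sum>i<m. ?f i)"
    by (rule sum.nat_diff_reindex)
  also have "\<dots> = seval (dd_convolution m) z2 z1"
    by (simp only: seval_dd_convolution)
  finally show ?thesis .
qed

lemma symmetric_a_hat: "symmetric_symbol (a_hat n)"
proof -
  have swap: "seval (a_hat n) z1 z2 = seval (a_hat n) z2 z1" for z1 z2
    by (simp only: a_hat_eq_convolution seval_diff seval_dd_convolution_swap[of _ z1])
  have "seval (a_hat n) (1 / z1) z2 = seval (a_hat n) z1 z2" if "z1 \<noteq> 0" for z1 z2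
    by (simp only: a_hat_eq_convolution seval_diff seval_dd_convolution
        leval_dubuc_deslauriers_inverse[OF that])
  then show ?thesis
    unfolding symmetric_symbol_def by (metis swap)
qed

lemma interpolatory_a_hat:
  assumes "n \<ge> 1"
  shows "interpolatory (a_hat n)"
  unfolding interpolatory_def
proof (intro allI impI)
  fix z1 z2 :: complex
  assume z: "z1 \<noteq> 0" "z2 \<noteq> 0"
  have "sign_sum (dd_convolution m) z1 z2 = 4 * of_nat m" for m
  proof -
    let ?U = "\<lambda>r z. leval (dubuc_deslauriers r) z"
    have "sign_sum (dd_convolution m) z1 z2 =
        (\<Sum>i<m. (?U (m - Suc i) z1 + ?U (m - Suc i) (- z1)) * (?U i z2 + ?U i (- z2)))"
      by (simp add: seval_dd_convolution algebra_simps flip: sum.distrib)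
    also have "\<dots> = 4 * of_nat m"
      by (simp add: leval_dubuc_deslauriers_minus z)
    finally show ?thesis .
  qed
  then have "sign_sum (a_hat n) z1 z2 = 4 * of_nat n - 4 * of_nat (n - 1)"
    by (simp add: a_hat_eq_convolution algebra_simps)
  then show "sign_sum (a_hat n) z1 z2 = 4"
    using assms by (simp add: of_nat_diff)
qed

lemma a_hat_Suc:
  "a_hat (Suc m) = tensor (dubuc_deslauriers m) (dubuc_deslauriers 0) +
    (\<Sum>i<m. tensor (dubuc_deslauriers (m - Suc i))
      (dubuc_deslauriers (Suc i) - dubuc_deslauriers i))"
  by (simp add: a_hat_eq_convolution dd_convolution_def sum.lessThan_Suc_shift
      tensor_diff_right sum_subtractf del: sum.lessThan_Suc)

lemma generates_polynomials_a_hat: "generates_polynomials (a_hat (Suc m)) (2 * m + 1)"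
proof (rule symmetric_generates_polynomialsI[OF symmetric_a_hat])
  fix k l z
  assume "k + l \<le> 2 * m + 1" and z: "z \<in> {1, - 1 :: complex}"
  have "seval (hasse_deriv2 (k, l) (tensor (dubuc_deslauriers (m - Suc i))
      (dubuc_deslauriers (Suc i) - dubuc_deslauriers i))) (- 1) z = 0" if "i < m" for i
  proof (cases "k < 2 * Suc (m - Suc i)")
    case True
    then show ?thesis
      by (simp add: hasse_deriv2_tensor seval_tensor hasse_deriv_dubuc_deslauriers_eq_0)
  next
    case False
    then have "l < 2 * Suc i"
      using \<open>k + l \<le> 2 * m + 1\<close> that by simp
    then show ?thesis
      using hasse_deriv_dubuc_deslauriers_Suc_diff_eq_0[OF _ z]
      by (simp add: hasse_deriv2_tensor seval_tensor)
  qed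
  moreover
  have "seval (hasse_deriv2 (k, l) (tensor (dubuc_deslauriers m) (dubuc_deslauriers 0))) (- 1) z = 0"
    using \<open>k + l \<le> 2 * m + 1\<close>
    by (simp add: hasse_deriv2_tensor seval_tensor hasse_deriv_dubuc_deslauriers_eq_0)
  ultimately show "seval (hasse_deriv2 (k, l) (a_hat (Suc m))) (- 1) z = 0"
    by (simp add: a_hat_Suc hasse_deriv2_def weighted_add weighted_sum)
qed

lemma coef_dd_convolution_octagon:
  assumes "coef (dd_convolution m) (x, y) \<noteq> 0"
  shows "(real_of_int x, real_of_int y) \<in> octagon (2 * real m - 1)"
proof -
  obtain i where "i < m"
    and "coef (dubuc_deslauriers (m - Suc i)) x * coef (dubuc_deslauriers i) y \<noteq> 0"
    using assms unfolding dd_convolution_def lookup_sum coef_tensor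
    by (elim sum.not_neutral_contains_not_neutral) auto
  then have "\<bar>x\<bar> \<le> 2 * int (m - Suc i) + 1" "\<bar>y\<bar> \<le> 2 * int i + 1"
    using keys_dubuc_deslauriers[of "m - Suc i"] keys_dubuc_deslauriers[of i]
    by (fastforce simp flip: in_keys_iff)+
  then have "\<bar>x\<bar> \<le> 2 * int m - 1" "\<bar>y\<bar> \<le> 2 * int m - 1" "\<bar>x\<bar> + \<bar>y\<bar> \<le> 2 * int m"
    using \<open>i < m\<close> by linarith+
  then show ?thesis
    unfolding octagon_def by (auto simp flip: of_int_abs)
qed

lemma octagon_mono: "d \<le> e \<Longrightarrow> octagon d \<subseteq> octagon e"
  by (auto simp: octagon_def)

lemma coef_a_hat_octagon:
  assumes "coef (a_hat n) (x, y) \<noteq> 0"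
  shows "(real_of_int x, real_of_int y) \<in> octagon (2 * real n - 1)"
proof -
  have "coef (dd_convolution n) (x, y) \<noteq> 0 \<or> coef (dd_convolution (n - 1)) (x, y) \<noteq> 0"
    using assms by (auto simp: a_hat_eq_convolution lookup_minus)
  then show ?thesis
    using coef_dd_convolution_octagon
      octagon_mono[of "2 * real (n - 1) - 1" "2 * real n - 1"]
    by auto
qed

lemma symbol_support_a_hat_subset:
  assumes "symmetric_symbol b" "interpolatory b" "generates_polynomials b (2 * m)"
  shows "symbol_support (a_hat (Suc m)) \<subseteq> symbol_support b"
proof (rule symbol_support_subset[OF convex_symbol_support])
  fix i j
  assume "coef (a_hat (Suc m)) (i, j) \<noteq> 0"
  then have "(real_of_int i, real_of_int j) \<in> octagon (2 * real m + 1)"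
    using coef_a_hat_octagon[of "Suc m" i j] by (simp add: add.commute)
  then show "(real_of_int i, real_of_int j) \<in> symbol_support b"
    using octagon_subset_symbol_support[OF assms] by blast
qed

lemma generates_polynomials_mono:
  "generates_polynomials a m \<Longrightarrow> l \<le> m \<Longrightarrow> generates_polynomials a l"
  unfolding generates_polynomials_def by fastforce

theorem proposition3p3:
  fixes n :: nat
  assumes "n \<ge> 1"
  shows "interpolatory (a_hat n) \<and>
    generates_polynomials (a_hat n) (2 * n - 1) \<and>
    reproduces_polynomials (a_hat n) (2 * n - 1) \<and>
    is_arg_min support_size
      (\<lambda>b. symmetric_symbol b \<and> interpolatory b \<and> generates_polynomials b (2 * n - 1))
      (a_hat n)"
proof -
  obtain m where m: "n = Suc m"
    using assms by (cases n) auto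
  have int: "interpolatory (a_hat n)"
    by (rule interpolatory_a_hat[OF assms])
  have gen: "generates_polynomials (a_hat n) (2 * n - 1)"
    using generates_polynomials_a_hat[of m] by (simp add: m)
  have "support_size (a_hat n) \<le> support_size b"
    if "symmetric_symbol b" "interpolatory b" "generates_polynomials b (2 * n - 1)" for b
    unfolding m using that generates_polynomials_mono[of b "2 * n - 1" "2 * m"]
    by (intro support_size_mono symbol_support_a_hat_subset) (auto simp: m)
  then show ?thesis
    using int gen interpolatory_generates_imp_reproduces[OF int gen] symmetric_a_hat
    by (auto simp: is_arg_min_def not_less)
qed

end
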